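(* Let $\lambda\ge0$. If $\theta\in\mathbf R^d$, $\Sigma\succeq O$ and $\mathcal Y\subseteq\mathcal X$ satisfy $$\theta-\theta^*\in S(\lambda,\mathcal Y;\Sigma)\quad\text{and}\quad x(\lambda;\theta,\Sigma),\ x(2\lambda;\theta^*,\Sigma)\in\mathcal Y,$$ then $$f^*(x(\lambda;\theta,\Sigma))\le f^*(x(2\lambda;\theta^*,\Sigma)).$$
   Context: $\mathcal X\subseteq\mathbf R^m$ is a decision domain, $f:\mathbf R^m\to\mathbf R$, and $g_1,\dots,g_K:\mathbf R^m\times\mathbf R^d\to\mathbf R$ are functions with $g_k(x,\theta)$ linear in $\theta$; $\theta^*\in\mathbf R^d$ is the true parameter. For a positive semidefinite $\Sigma$, $U_\Sigma=\{u\in\mathbf R^d:u^\top\Sigma^{-1}u\le1\}$ (for singular $\Sigma$ read as the image of the closed Euclidean unit ball under $\Sigma^{1/2}$), and $r_k(x;\Sigma)=\max_{u\in U_\Sigma}g_k(x,u)$. For $\lambda\ge0$, $x(\lambda;\theta,\Sigma)$ denotes an optimal solution (assumed to exist) of the robust problem: minimize $f(x)$ over $x\in\mathcal X$ subject to $\min_{u\in U_\Sigma}g_k(x,\theta+\lambda u)\ge0$ for $k=1,\dots,K$. The true objective is $f^*(x)=f(x)$ if $g_k(x,\theta^* )\ge0$ for all $k=1,\dots,K$, and $f^*(x)=\infty$ otherwise. For $\mathcal Y\subseteq\mathcal X$, $S(\lambda,\mathcal Y;\Sigma)=\{\Delta\in\mathbf R^d:|g_k(y,\Delta)|\le\lambda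 r_k(y;\Sigma)\ \forall y\in\mathcal Y,\ k=1,\dots,K\}$. *)

theory Defs
  imports "HOL-Analysis.Analysis"
begin

definition pos_semidef :: "real^'n^'n \<Rightarrow> bool" where
  "pos_semidef A \<longleftrightarrow> transpose A = A \<and> (\<forall>v. 0 \<le> v \<bullet> (A *v v))"

definition psd_sqrt :: "real^'n^'n \<Rightarrow> real^'n^'n" where
  "psd_sqrt A = (THE R. pos_semidef R \<and> R ** R = A)"

definition uncertainty_set :: "real^'d^'d \<Rightarrow> (real^'d) set" where
  "uncertainty_set \<Sigma> =
     (if invertible \<Sigma> then {u. u \<bullet> (matrix_inv \<Sigma> *v u) \<le> 1}
      else (\<lambda>v. psd_sqrt \<Sigma> *v v) ` cball 0 1)"

lemma zero_in_uncertainty_set: "0 \<in> uncertainty_set \<Sigma>"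
  by (auto simp: uncertainty_set_def image_iff intro!: bexI[of _ 0])

lemma compact_uncertainty_set:
  assumes psd: "pos_semidef \<Sigma>"
  shows "compact (uncertainty_set \<Sigma>)"
proof (cases "invertible \<Sigma>")
  case False
  then show ?thesis
    by (auto simp: uncertainty_set_def intro!: compact_continuous_image
        linear_continuous_on bounded_linearI')
       (simp_all add: matrix_vector_right_distrib matrix_vector_mult_scaleR)
next
  case True
  define B where "B = matrix_inv \<Sigma>"
  have SB: "\<Sigma> *v (B *v u) = u" for u
  proof -
    have "\<Sigma> ** B = mat 1"
      using True someI_ex[of "\<lambda>A'. \<Sigma> ** A' = mat 1 \<and> A' ** \<Sigma> = mat 1"]
      by (simp add: B_def matrix_inv_def invertible_def)
    then show ?thesis by (simp add: matrix_vector_mul_assoc)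
  qed
  have sym: "(\<Sigma> *v x) \<bullet> y = x \<bullet> (\<Sigma> *v y)" for x y
    using psd dot_lmul_matrix[of x \<Sigma> y] unfolding pos_semidef_def
    by (metis transpose_matrix_vector)
  have nonneg: "0 \<le> v \<bullet> (\<Sigma> *v v)" for v
    using psd by (simp add: pos_semidef_def)
  have zero: "\<Sigma> *v v = 0" if v: "v \<bullet> (\<Sigma> *v v) = 0" for v
  proof (rule ccontr)
    define w where "w = \<Sigma> *v v"
    assume "\<Sigma> *v v \<noteq> 0"
    then have a: "0 < w \<bullet> w" by (simp add: w_def)
    define c where "c = w \<bullet> (\<Sigma> *v w)"
    define t where "t = - (w \<bullet> w) / (c + 1)"
    have c: "0 \<le> c" unfolding c_def by (rule nonneg)
    have "(v + t *\<^sub>R w) \<bullet> (\<Sigma> *v (v + t *\<^sub>R w))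
        = v \<bullet> (\<Sigma> *v v) + t * (v \<bullet> (\<Sigma> *v w)) + t * (w \<bullet> (\<Sigma> *v v)) + t * t * c"
      by (simp add: matrix_vector_right_distrib matrix_vector_mult_scaleR inner_add_left
          inner_add_right c_def algebra_simps)
    also have "\<dots> = t * (2 * (w \<bullet> w) + t * c)"
      using v sym[of v w] by (simp add: w_def algebra_simps)
    also have "\<dots> < 0"
    proof -
      have "t < 0" using a c by (simp add: t_def divide_neg_pos)
      moreover have "(w \<bullet> w) * (c / (c + 1)) \<le> (w \<bullet> w) * 1"
        using a c by (intro mult_left_mono) auto
      then have "- (w \<bullet> w) \<le> t * c" by (simp add: t_def)
      then have "0 < 2 * (w \<bullet> w) + t * c" using a by linarith
      ultimately show ?thesis by (rule mult_neg_pos)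
    qed
    finally show False using nonneg[of "v + t *\<^sub>R w"] by simp
  qed
  have pos: "0 < u \<bullet> (B *v u)" if "u \<noteq> 0" for u
  proof -
    have eq: "u \<bullet> (B *v u) = (B *v u) \<bullet> (\<Sigma> *v (B *v u))"
      by (simp add: SB inner_commute)
    have "\<Sigma> *v (B *v u) \<noteq> 0" using that by (simp only: SB not_False_eq_True)
    then have "(B *v u) \<bullet> (\<Sigma> *v (B *v u)) \<noteq> 0" using zero by blast
    then show ?thesis using nonneg[of "B *v u"] unfolding eq by linarith
  qed
  have cont: "continuous_on A (\<lambda>u. u \<bullet> (B *v u))" for A
    by (intro continuous_intros linear_continuous_on
        matrix_vector_mul_bounded_linear)
  have "closed {u. u \<bullet> (B *v u) \<le> 1}"
    by (intro closed_Collect_le cont continuous_on_const)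
  moreover have "bounded {u. u \<bullet> (B *v u) \<le> 1}"
  proof -
    have "sphere (0::real^'a) 1 \<noteq> {}" by simp
    then obtain e where e: "e \<in> sphere 0 1"
      and em: "\<And>y. y \<in> sphere 0 1 \<Longrightarrow> e \<bullet> (B *v e) \<le> y \<bullet> (B *v y)"
      using continuous_attains_inf[OF compact_sphere _ cont, of 0 1] by blast
    define m where "m = e \<bullet> (B *v e)"
    have m: "0 < m" unfolding m_def using e by (intro pos) auto
    have "norm u \<le> 1 / m + 1" if u: "u \<bullet> (B *v u) \<le> 1" for u
    proof (cases "u = 0")
      case False
      have "m \<le> (u /\<^sub>R norm u) \<bullet> (B *v (u /\<^sub>R norm u))"
        unfolding m_def using False by (intro em) simp
      also have "\<dots> = (u \<bullet> (B *v u)) / (norm u)\<^sup>2"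
        by (simp add: matrix_vector_mult_scaleR power2_eq_square divide_inverse)
      finally have "m * (norm u)\<^sup>2 \<le> 1"
        using u False by (simp add: pos_le_divide_eq)
      then have "(norm u)\<^sup>2 \<le> 1 / m" using m by (simp add: field_simps)
      also have "\<dots> \<le> (1 / m + 1)\<^sup>2"
      proof -
        have "0 < 1 / m" using m by simp
        moreover have "(1 / m + 1)\<^sup>2 = (1 / m)\<^sup>2 + 2 * (1 / m) + 1"
          by (simp add: power2_sum)
        ultimately show ?thesis using zero_le_power2[of "1 / m"] by linarith
      qed
      finally show ?thesis by (rule power2_le_imp_le) (use m in simp)
    qed (use m in simp)
    then show ?thesis unfolding bounded_iff by blast
  qed
  ultimately have "compact {u. u \<bullet> (B *v u) \<le> 1}"
    by (simp add: compact_eq_bounded_closed)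
  then show ?thesis using True by (simp add: uncertainty_set_def B_def)
qed

text \<open>
  The maximum over the uncertainty set is written as a supremum and the minimum as an infimum.
  For positive semidefinite \<open>\<Sigma>\<close> and constraint functions linear in the parameter both are
  attained, as the uncertainty set is compact and nonempty.
\<close>

definition robust_margin ::
  "(nat \<Rightarrow> 'x \<Rightarrow> real^'d \<Rightarrow> real) \<Rightarrow> nat \<Rightarrow> 'x \<Rightarrow> real^'d^'d \<Rightarrow> real" where
  "robust_margin g k x \<Sigma> = (SUP u \<in> uncertainty_set \<Sigma>. g k x u)"

definition robust_feasible ::
  "'x set \<Rightarrow> nat \<Rightarrow> (nat \<Rightarrow> 'x \<Rightarrow> real^'d \<Rightarrow> real) \<Rightarrow> real \<Rightarrow> real^'d \<Rightarrow> real^'d^'d \<Rightarrow> 'x set" where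
  "robust_feasible X K g lam \<theta> \<Sigma> =
     {x \<in> X. \<forall>k\<in>{1..K}. (INF u \<in> uncertainty_set \<Sigma>. g k x (\<theta> + lam *\<^sub>R u)) \<ge> 0}"

definition robust_optimal ::
  "'x set \<Rightarrow> ('x \<Rightarrow> real) \<Rightarrow> nat \<Rightarrow> (nat \<Rightarrow> 'x \<Rightarrow> real^'d \<Rightarrow> real)
     \<Rightarrow> real \<Rightarrow> real^'d \<Rightarrow> real^'d^'d \<Rightarrow> 'x \<Rightarrow> bool" where
  "robust_optimal X f K g lam \<theta> \<Sigma> x \<longleftrightarrow>
     x \<in> robust_feasible X K g lam \<theta> \<Sigma> \<and>
     (\<forall>y \<in> robust_feasible X K g lam \<theta> \<Sigma>. f x \<le> f y)"

definition true_objective ::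
  "('x \<Rightarrow> real) \<Rightarrow> nat \<Rightarrow> (nat \<Rightarrow> 'x \<Rightarrow> real^'d \<Rightarrow> real) \<Rightarrow> real^'d \<Rightarrow> 'x \<Rightarrow> ereal" where
  "true_objective f K g \<theta>' x = (if \<forall>k\<in>{1..K}. g k x \<theta>' \<ge> 0 then ereal (f x) else \<infinity>)"

definition error_set ::
  "nat \<Rightarrow> (nat \<Rightarrow> 'x \<Rightarrow> real^'d \<Rightarrow> real) \<Rightarrow> real \<Rightarrow> 'x set \<Rightarrow> real^'d^'d \<Rightarrow> (real^'d) set" where
  "error_set K g lam Y \<Sigma> =
     {\<Delta>. \<forall>y\<in>Y. \<forall>k\<in>{1..K}. \<bar>g k y \<Delta>\<bar> \<le> lam * robust_margin g k y \<Sigma>}"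

lemma robust_margin_attained:
  fixes g :: "nat \<Rightarrow> 'x \<Rightarrow> real^'d \<Rightarrow> real"
  assumes "pos_semidef \<Sigma>" and "linear (g k x)"
  shows "\<exists>u\<in>uncertainty_set \<Sigma>. robust_margin g k x \<Sigma> = g k x u
           \<and> (\<forall>v\<in>uncertainty_set \<Sigma>. g k x v \<le> g k x u)"
proof -
  have "continuous_on (uncertainty_set \<Sigma>) (g k x)"
    using assms(2) by (simp add: linear_continuous_on linear_conv_bounded_linear)
  then obtain u where u: "u \<in> uncertainty_set \<Sigma>" "\<forall>v\<in>uncertainty_set \<Sigma>. g k x v \<le> g k x u"
    using continuous_attains_sup[OF compact_uncertainty_set[OF assms(1)]]
      zero_in_uncertainty_set by blast
  then have "robust_margin g k x \<Sigma> = g k x u"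
    unfolding robust_margin_def by (intro cSup_eq_maximum) auto
  with u show ?thesis by blast
qed

lemma worst_case_attained:
  fixes g :: "nat \<Rightarrow> 'x \<Rightarrow> real^'d \<Rightarrow> real"
  assumes "pos_semidef \<Sigma>" and "linear (g k x)"
  shows "\<exists>u\<in>uncertainty_set \<Sigma>.
           (INF v\<in>uncertainty_set \<Sigma>. g k x (\<theta> + lam *\<^sub>R v)) = g k x (\<theta> + lam *\<^sub>R u)
           \<and> (\<forall>v\<in>uncertainty_set \<Sigma>. g k x (\<theta> + lam *\<^sub>R u) \<le> g k x (\<theta> + lam *\<^sub>R v))"
proof -
  have "continuous_on A (g k x)" for A
    using assms(2) by (simp add: linear_continuous_on linear_conv_bounded_linear)
  then have "continuous_on (uncertainty_set \<Sigma>) (\<lambda>v. g k x (\<theta> + lam *\<^sub>R v))"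
    by (rule continuous_on_compose2[where t = UNIV]) (intro continuous_intros, simp)
  then obtain u where u: "u \<in> uncertainty_set \<Sigma>"
      "\<forall>v\<in>uncertainty_set \<Sigma>. g k x (\<theta> + lam *\<^sub>R u) \<le> g k x (\<theta> + lam *\<^sub>R v)"
    using continuous_attains_inf[OF compact_uncertainty_set[OF assms(1)]]
      zero_in_uncertainty_set by blast
  then have "(INF v\<in>uncertainty_set \<Sigma>. g k x (\<theta> + lam *\<^sub>R v)) = g k x (\<theta> + lam *\<^sub>R u)"
    by (intro cInf_eq_minimum) auto
  with u show ?thesis by blast
qed

end

theory Submission
  imports Defs
begin

text \<open>
  Since the uncertainty set is symmetric about the origin and the constraint functions are linear
  in the parameter, for \<open>lam \<ge> 0\<close> the worst case of \<open>g k x (\<theta> + lam *\<^sub>R u)\<close> over the uncertainty set is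
  \<open>g k x \<theta> - lam * robust_margin g k x \<Sigma>\<close>. Robust feasibility of \<open>x\<close> at level \<open>lam\<close> thus
  says that every constraint holds at \<open>\<theta>\<close> with slack at least \<open>lam\<close> times the margin
  (\<open>robust_feasible_iff\<close>), while membership of \<open>\<theta> - \<theta>_star\<close> in the error set says that on \<open>Y\<close>,
  passing between \<open>\<theta>\<close> and \<open>\<theta>_star\<close> costs at most \<open>lam\<close> times the margin.

  Hence the robust solution at \<open>\<theta>\<close> with level \<open>lam\<close> satisfies the true constraints, so its true
  objective is its value of \<open>f\<close>; and the robust solution at \<open>\<theta>_star\<close> with level \<open>2 * lam\<close>
  retains slack \<open>lam\<close> at \<open>\<theta>\<close>, so it competes in the robust problem at \<open>\<theta>\<close> and cannot have a
  smaller value of \<open>f\<close>; its true objective is at least that value.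
\<close>

lemma uncertainty_set_uminus:
  assumes "u \<in> uncertainty_set \<Sigma>"
  shows "- u \<in> uncertainty_set \<Sigma>"
proof (cases "invertible \<Sigma>")
  case True
  with assms show ?thesis
    by (simp add: uncertainty_set_def linear_neg[OF matrix_vector_mul_linear])
next
  case False
  with assms obtain v where "v \<in> cball 0 1" "u = psd_sqrt \<Sigma> *v v"
    by (auto simp: uncertainty_set_def)
  then have "- v \<in> cball 0 1" "- u = psd_sqrt \<Sigma> *v (- v)"
    by (simp_all add: linear_neg[OF matrix_vector_mul_linear])
  with False show ?thesis
    unfolding uncertainty_set_def by (metis image_eqI)
qed

lemma worst_case_eq:
  fixes g :: "nat \<Rightarrow> 'x \<Rightarrow> real^'d \<Rightarrow> real"
  assumes psd: "pos_semidef \<Sigma>" and lin: "linear (g k x)" and lam: "lam \<ge> 0"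
  shows "(INF u\<in>uncertainty_set \<Sigma>. g k x (\<theta> + lam *\<^sub>R u))
           = g k x \<theta> - lam * robust_margin g k x \<Sigma>"
proof -
  obtain u where u: "u \<in> uncertainty_set \<Sigma>" "robust_margin g k x \<Sigma> = g k x u"
      "\<And>v. v \<in> uncertainty_set \<Sigma> \<Longrightarrow> g k x v \<le> g k x u"
    using robust_margin_attained[of \<Sigma> g k x] psd lin by blast
  have expand: "g k x (\<theta> + lam *\<^sub>R v) = g k x \<theta> + lam * g k x v" for v
    by (simp add: linear_add[OF lin] linear_cmul[OF lin])
  have neg: "g k x (- v) = - g k x v" for v
    by (rule linear_neg[OF lin])
  have "g k x \<theta> - lam * g k x u \<le> g k x (\<theta> + lam *\<^sub>R v)" if "v \<in> uncertainty_set \<Sigma>" for v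
  proof -
    have "- g k x v \<le> g k x u"
      using u(3)[OF uncertainty_set_uminus[OF that]] by (simp add: neg)
    then have "lam * (- g k x v) \<le> lam * g k x u"
      using lam by (rule mult_left_mono)
    then show ?thesis
      by (simp add: expand)
  qed
  moreover have "g k x (\<theta> + lam *\<^sub>R (- u)) = g k x \<theta> - lam * g k x u"
    by (simp only: expand neg)
  ultimately show ?thesis
    unfolding u(2) using uncertainty_set_uminus[OF u(1)]
    by (intro cInf_eq_minimum) (force intro: image_eqI[where x = "- u"])+
qed

lemma robust_feasible_iff:
  fixes g :: "nat \<Rightarrow> 'x \<Rightarrow> real^'d \<Rightarrow> real"
  assumes "pos_semidef \<Sigma>" and "\<And>k. k \<in> {1..K} \<Longrightarrow> linear (g k x)" and "lam \<ge> 0"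
  shows "x \<in> robust_feasible X K g lam \<theta> \<Sigma> \<longleftrightarrow>
           x \<in> X \<and> (\<forall>k\<in>{1..K}. lam * robust_margin g k x \<Sigma> \<le> g k x \<theta>)"
  using assms by (simp add: robust_feasible_def worst_case_eq)

theorem lemma5:
  fixes X Y :: "(real^'m) set"
    and f :: "real^'m \<Rightarrow> real"
    and K :: nat
    and g :: "nat \<Rightarrow> real^'m \<Rightarrow> real^'d \<Rightarrow> real"
    and \<theta>_star \<theta> :: "real^'d"
    and \<Sigma> :: "real^'d^'d"
    and lam :: real
    and xsol :: "real \<Rightarrow> real^'d \<Rightarrow> real^'d^'d \<Rightarrow> real^'m"
  assumes g_linear: "\<And>k x. k \<in> {1..K} \<Longrightarrow> linear (g k x)"
    and lam_nonneg: "lam \<ge> 0"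
    and psd: "pos_semidef \<Sigma>"
    and Y_sub: "Y \<subseteq> X"
    and opt_est: "robust_optimal X f K g lam \<theta> \<Sigma> (xsol lam \<theta> \<Sigma>)"
    and opt_true: "robust_optimal X f K g (2 * lam) \<theta>_star \<Sigma> (xsol (2 * lam) \<theta>_star \<Sigma>)"
    and error: "\<theta> - \<theta>_star \<in> error_set K g lam Y \<Sigma>"
    and sol_est_in: "xsol lam \<theta> \<Sigma> \<in> Y"
    and sol_true_in: "xsol (2 * lam) \<theta>_star \<Sigma> \<in> Y"
  shows "true_objective f K g \<theta>_star (xsol lam \<theta> \<Sigma>)
           \<le> true_objective f K g \<theta>_star (xsol (2 * lam) \<theta>_star \<Sigma>)"
proof -
  let ?x = "xsol lam \<theta> \<Sigma>" and ?y = "xsol (2 * lam) \<theta>_star \<Sigma>"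
  have err: "\<bar>g k z \<theta> - g k z \<theta>_star\<bar> \<le> lam * robust_margin g k z \<Sigma>"
    if "k \<in> {1..K}" "z \<in> Y" for k z
    using error that by (auto simp: error_set_def simp flip: linear_diff[OF g_linear])

  have feasible_iff: "z \<in> robust_feasible X K g l \<eta> \<Sigma> \<longleftrightarrow>
      z \<in> X \<and> (\<forall>k\<in>{1..K}. l * robust_margin g k z \<Sigma> \<le> g k z \<eta>)" if "l \<ge> 0" for z l \<eta>
    using psd g_linear that by (rule robust_feasible_iff)

  have x_slack: "lam * robust_margin g k ?x \<Sigma> \<le> g k ?x \<theta>" if "k \<in> {1..K}" for k
    using opt_est that lam_nonneg
    by (simp add: robust_optimal_def feasible_iff)
  have "g k ?x \<theta>_star \<ge> 0" if "k \<in> {1..K}" for k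
    using x_slack[OF that] err[OF that sol_est_in] by linarith
  then have x_obj: "true_objective f K g \<theta>_star ?x = ereal (f ?x)"
    by (simp add: true_objective_def)

  have y_slack: "2 * lam * robust_margin g k ?y \<Sigma> \<le> g k ?y \<theta>_star" if "k \<in> {1..K}" for k
    using opt_true that lam_nonneg
    by (simp add: robust_optimal_def feasible_iff)
  have "lam * robust_margin g k ?y \<Sigma> \<le> g k ?y \<theta>" if "k \<in> {1..K}" for k
    using y_slack[OF that] err[OF that sol_true_in] by linarith
  then have "?y \<in> robust_feasible X K g lam \<theta> \<Sigma>"
    using sol_true_in Y_sub lam_nonneg by (auto simp: feasible_iff)
  then have "f ?x \<le> f ?y"
    using opt_est by (simp add: robust_optimal_def)
  then show ?thesis
    by (simp add: x_obj) (simp add: true_objective_def)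
qed

end
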